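(* Let $0\le\alpha<1$. The radii $R_{\mathcal{S}^*(\alpha)}(\mathcal{G}_i)$, $i=1,2,3$, of the classes $\mathcal{G}_1,\mathcal{G}_2,\mathcal{G}_3$ with respect to the class $\mathcal{S}^*(\alpha)$ of starlike functions of order $\alpha$ are exactly: (i) $R_{\mathcal{S}^{*}(\alpha)}(\mathcal{G}_1)= \dfrac{1-\alpha}{3+\sqrt{10-2\alpha+\alpha^2}}$; (ii) $R_{\mathcal{S}^{*}(\alpha)}(\mathcal{G}_2)= \dfrac{2(1-\alpha)}{5+\sqrt{25-4\alpha+4\alpha^2}}$; (iii) $R_{\mathcal{S}^{*}(\alpha)}(\mathcal{G}_3)= \dfrac{1-\alpha}{2+\sqrt{5-2\alpha+\alpha^2}}$.
   Context: $\mathbb{D}$ is the open unit disc in $\mathbb{C}$. $\mathcal{A}$ is the class of analytic functions $f$ on $\mathbb{D}$ with $f(0)=0$, $f'(0)=1$. $\mathcal{P}$ is the class of analytic functions $p$ on $\mathbb{D}$ with $p(0)=1$ and $\operatorname{Re}p(z)>0$ for all $z\in\mathbb{D}$; for $0\le\beta<1$, $\mathcal{P}(\beta)=\{p\in\mathcal{P}:\operatorname{Re}p(z)>\beta \text{ for all } z\in\mathbb{D}\}$. Quotients below are understood with removable singularities filled in (in particular at $0$). Define $\mathcal{G}_1=\{f\in\mathcal{A}: f/g\in\mathcal{P}\text{ and } g/(zp)\in\mathcal{P}\text{ for some } g\in\mathcal{A},\ p\in\mathcal{P}\}$, $\mathcal{G}_2=\{f\in\mathcal{A}: f/g\in\mathcal{P}\text{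 and } g/(zp)\in\mathcal{P}(1/2)\text{ for some } g\in\mathcal{A},\ p\in\mathcal{P}\}$, $\mathcal{G}_3=\{f\in\mathcal{A}: f/(zp)\in\mathcal{P}\text{ for some } p\in\mathcal{P}\}$. For subclasses $\mathcal{F},\mathcal{G}$ of $\mathcal{A}$, the $\mathcal{G}$-radius $R_{\mathcal{G}}(\mathcal{F})$ of $\mathcal{F}$ is the largest number $R\in(0,1)$ such that, for every $f\in\mathcal{F}$ and every $0<r<R$, the function $z\mapsto r^{-1}f(rz)$ belongs to $\mathcal{G}$. $\mathcal{S}^*(\alpha)=\{f\in\mathcal{A}:\operatorname{Re}(zf'(z)/f(z))>\alpha \text{ for all } z\in\mathbb{D}\}$, where $zf'(z)/f(z)$ is analytic on $\mathbb{D}$ with value $1$ at $0$. *)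

theory Defs
  imports "HOL-Complex_Analysis.Complex_Analysis"
begin

text \<open>
  A function on the open unit disc is represented by a total function on the complex numbers.
  Every notion below depends only on its values on \<^term>\<open>ball (0::complex) 1\<close>.
\<close>

definition class_A :: "(complex \<Rightarrow> complex) set" where
  "class_A = {f. f holomorphic_on ball 0 1 \<and> f 0 = 0 \<and> deriv f 0 = 1}"

definition class_P :: "(complex \<Rightarrow> complex) set" where
  "class_P = {p. p holomorphic_on ball 0 1 \<and> p 0 = 1 \<and> (\<forall>z\<in>ball 0 1. Re (p z) > 0)}"

definition class_P_ord :: "real \<Rightarrow> (complex \<Rightarrow> complex) set" where
  "class_P_ord \<beta> = {p \<in> class_P. \<forall>z\<in>ball 0 1. Re (p z) > \<beta>}"

text \<open>
  Quotients are meromorphic, and \<^const>\<open>remove_sings\<close> fills in their removable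
  singularities. It has value \<open>0\<close> at a pole, so a quotient with a pole in the disc never
  satisfies the strict lower bounds on the real part (by a number \<open>\<ge> 0\<close>) imposed below.
\<close>

definition class_G1 :: "(complex \<Rightarrow> complex) set" where
  "class_G1 = {f \<in> class_A. \<exists>g\<in>class_A. \<exists>p\<in>class_P.
     remove_sings (\<lambda>z. f z / g z) \<in> class_P \<and>
     remove_sings (\<lambda>z. g z / (z * p z)) \<in> class_P}"

definition class_G2 :: "(complex \<Rightarrow> complex) set" where
  "class_G2 = {f \<in> class_A. \<exists>g\<in>class_A. \<exists>p\<in>class_P.
     remove_sings (\<lambda>z. f z / g z) \<in> class_P \<and>
     remove_sings (\<lambda>z. g z / (z * p z)) \<in> class_P_ord (1/2)}"

definition class_G3 :: "(complex \<Rightarrow> complex) set" where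
  "class_G3 = {f \<in> class_A. \<exists>p\<in>class_P. remove_sings (\<lambda>z. f z / (z * p z)) \<in> class_P}"

text \<open>The value \<open>1\<close> of the filled-in quotient at \<open>0\<close> is automatic from \<open>f 0 = 0\<close> and
  \<open>deriv f 0 = 1\<close>.\<close>

definition starlike_ord :: "real \<Rightarrow> (complex \<Rightarrow> complex) set" where
  "starlike_ord \<alpha> = {f \<in> class_A.
     remove_sings (\<lambda>z. z * deriv f z / f z) holomorphic_on ball 0 1 \<and>
     (\<forall>z\<in>ball 0 1. Re (remove_sings (\<lambda>z. z * deriv f z / f z) z) > \<alpha>)}"

definition radius_admissible ::
  "(complex \<Rightarrow> complex) set \<Rightarrow> (complex \<Rightarrow> complex) set \<Rightarrow> real \<Rightarrow> bool" where
  "radius_admissible G F R \<longleftrightarrow>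
     0 < R \<and> R < 1 \<and> (\<forall>f\<in>F. \<forall>r. 0 < r \<and> r < R \<longrightarrow> (\<lambda>z. f (of_real r * z) / of_real r) \<in> G)"

text \<open>The \<open>G\<close>-radius of \<open>F\<close> exists and equals \<open>R\<close>: the largest admissible number exists and
  is \<open>R\<close>.\<close>

definition has_class_radius ::
  "(complex \<Rightarrow> complex) set \<Rightarrow> (complex \<Rightarrow> complex) set \<Rightarrow> real \<Rightarrow> bool" where
  "has_class_radius G F R \<longleftrightarrow>
     radius_admissible G F R \<and> (\<forall>R'. radius_admissible G F R' \<longrightarrow> R' \<le> R)"

end

theory Submission
  imports Defs
begin

text \<open>
  Write \<open>E q (z) = z q'(z) / q(z)\<close>. A member of one of the three classes factors as
  \<open>f(z) = z q(z)\<close>, where \<open>q\<close> is a product of two or three functions with positive real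
  part, hence zero-free; in the second class one of the factors has real part above \<open>1/2\<close>.
  Since \<open>z f'(z) / f(z) = 1 + E q (z)\<close>, and \<open>E\<close> turns products into sums, the radius is
  found by minimising the real part of \<open>E p\<close> on \<open>|z| = r\<close> for each kind of factor \<open>p\<close>
  separately and adding up.

  For \<open>p\<close> with positive real part, the Schwarz--Pick inequality for \<open>(p - 1) / (p + 1)\<close>
  gives \<open>Re (E p (z)) \<ge> - 2 r / (1 - r\<^sup>2)\<close> (lemma \<open>class_P_euler_log_deriv_ge\<close>). For \<open>p\<close>
  with real part above \<open>1/2\<close>, the function \<open>1/p - 1\<close> is a self-map of the disc fixing
  \<open>0\<close>, so it is \<open>z \<phi>(z)\<close> with \<open>|\<phi>| \<le> 1\<close>. Here the Schwarz--Pick inequality for \<open>\<phi>\<close>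
  gives \<open>Re (E p (z)) \<ge> - r / (1 + r)\<close> for \<open>r \<le> 1/3\<close> (lemma
  \<open>class_P_half_euler_log_deriv_ge\<close>). This is stronger than the bound \<open>- r / (1 - r)\<close> that
  comes from estimating the modulus of \<open>E p\<close>. The restriction on \<open>r\<close> is harmless, because
  the radius of the second class never exceeds \<open>1/3\<close>.

  All these bounds are attained at the same point \<open>z = -r\<close>, by \<open>(1 + z) / (1 - z)\<close> and by
  \<open>1 / (1 - z)\<close>, so their sums are sharp for products as well. The three radii are therefore
  the numbers \<open>r\<close> in the unit interval that solve \<open>6 r / (1 - r\<^sup>2) = 1 - \<alpha>\<close>,
  \<open>4 r / (1 - r\<^sup>2) + r / (1 + r) = 1 - \<alpha>\<close> and \<open>4 r / (1 - r\<^sup>2) = 1 - \<alpha>\<close>, which are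
  quadratic equations.
\<close>

section \<open>The Schwarz--Pick inequality\<close>

lemma Moebius_function_has_field_derivative:
  assumes "1 - cnj w * z \<noteq> 0"
  shows "(Moebius_function 0 w has_field_derivative (1 - cnj w * w) / (1 - cnj w * z)\<^sup>2) (at z)"
proof -
  have "((\<lambda>z. (z - w) / (1 - cnj w * z)) has_field_derivative
          (1 - cnj w * w) / (1 - cnj w * z)\<^sup>2) (at z)"
    using assms
    by (auto intro!: derivative_eq_intros simp: power2_eq_square divide_simps) (simp add: algebra_simps)
  moreover have "Moebius_function 0 w = (\<lambda>z. (z - w) / (1 - cnj w * z))"
    by (simp add: fun_eq_iff Moebius_function_simple)
  ultimately show ?thesis by simp
qed

lemma one_minus_cnj_mult_self: "1 - cnj w * w = of_real (1 - (norm w)\<^sup>2)"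
  by (simp add: complex_norm_square[symmetric] mult.commute[of "cnj w"])

text \<open>
  Moebius transformations carry \<open>0\<close> to \<open>a\<close> and \<open>f a\<close> to \<open>0\<close>. Conjugating \<open>f\<close> by them
  reduces the claim to the bound on the derivative at the origin in the Schwarz lemma; the
  two extra factors are the derivatives of the transformations.
\<close>
lemma Schwarz_Pick_deriv_strict:
  assumes holf: "f holomorphic_on ball 0 1"
    and lt1: "\<And>z. norm z < 1 \<Longrightarrow> norm (f z) < 1"
    and a: "norm a < 1"
  shows "norm (deriv f a) * (1 - (norm a)\<^sup>2) \<le> 1 - (norm (f a))\<^sup>2"
proof -
  define h where "h = Moebius_function 0 (f a) \<circ> f \<circ> Moebius_function 0 (-a)"
  have fa: "norm (f a) < 1" using lt1 a by simp
  have M0: "Moebius_function 0 (-a) 0 = a" by (simp add: Moebius_function_of_zero)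
  have pos: "1 - (norm a)\<^sup>2 > 0" "1 - (norm (f a))\<^sup>2 > 0"
    using a fa by (simp_all add: abs_square_less_1 power_less_one_iff)
  have nz: "1 - cnj (f a) * f a \<noteq> 0"
    using pos(2) unfolding one_minus_cnj_mult_self of_real_eq_0_iff by linarith
  have "h holomorphic_on ball 0 1"
    unfolding h_def
  proof (intro holomorphic_on_compose_gen)
    show "Moebius_function 0 (-a) holomorphic_on ball 0 1"
         "Moebius_function 0 (f a) holomorphic_on ball 0 1"
      using a fa by (simp_all add: Moebius_function_holomorphic)
  qed (use a lt1 Moebius_function_norm_lt_1 holf in auto)
  moreover have "h 0 = 0" by (simp add: h_def M0 Moebius_function_eq_zero)
  moreover have "norm (h z) < 1" if "norm z < 1" for z
    using that a fa by (simp add: h_def Moebius_function_norm_lt_1 lt1)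
  ultimately have h': "norm (deriv h 0) \<le> 1"
    using Schwarz_Lemma(2)[of h 0] by auto
  have d1: "(Moebius_function 0 (-a) has_field_derivative (1 - cnj a * a)) (at 0)"
    using Moebius_function_has_field_derivative[of "-a" 0] by simp
  have d2: "(f has_field_derivative deriv f a) (at (Moebius_function 0 (-a) 0))"
    using holf a M0 by (simp add: holomorphic_derivI[where S = "ball 0 1"])
  have d3: "(Moebius_function 0 (f a) has_field_derivative inverse (1 - cnj (f a) * f a))
              (at (f (Moebius_function 0 (-a) 0)))"
    using Moebius_function_has_field_derivative[of "f a" "f a"] nz M0
    by (simp add: power2_eq_square divide_simps)
  have "(h has_field_derivative inverse (1 - cnj (f a) * f a) * (deriv f a * (1 - cnj a * a))) (at 0)"
    unfolding h_def o_assoc[symmetric]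
    by (rule DERIV_chain[OF _ DERIV_chain[OF d2 d1]]) (simp add: d3)
  hence h0: "deriv h 0 = inverse (1 - cnj (f a) * f a) * (deriv f a * (1 - cnj a * a))"
    by (rule DERIV_imp_deriv)
  have "norm (deriv h 0) = norm (deriv f a) * (1 - (norm a)\<^sup>2) / (1 - (norm (f a))\<^sup>2)"
    using pos unfolding h0 one_minus_cnj_mult_self norm_mult norm_inverse norm_of_real
    by (simp add: divide_simps)
  hence "norm (deriv f a) * (1 - (norm a)\<^sup>2) / (1 - (norm (f a))\<^sup>2) \<le> 1"
    using h' by simp
  thus ?thesis using pos by (simp add: divide_le_eq)
qed

text \<open>
  The case of values on the closed disc is needed for the quotient \<open>\<phi>(z) = w(z) / z\<close> of
  the Schwarz lemma, which is a unimodular constant when \<open>w\<close> is a rotation. It follows from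
  the strict case for \<open>t f\<close> by letting \<open>t\<close> tend to \<open>1\<close> from below.
\<close>
lemma Schwarz_Pick_deriv:
  assumes holf: "f holomorphic_on ball 0 1"
    and le1: "\<And>z. norm z < 1 \<Longrightarrow> norm (f z) \<le> 1"
    and a: "norm a < 1"
  shows "norm (deriv f a) * (1 - (norm a)\<^sup>2) \<le> 1 - (norm (f a))\<^sup>2"
proof -
  have *: "t * norm (deriv f a) * (1 - (norm a)\<^sup>2) \<le> 1 - t\<^sup>2 * (norm (f a))\<^sup>2"
    if t: "0 < t" "t < 1" for t :: real
  proof -
    have "norm (of_real t * f z) < 1" if "norm z < 1" for z
    proof -
      have "norm (of_real t * f z) \<le> t * 1"
        using le1[OF that] t by (simp add: norm_mult)
      thus ?thesis using t by linarith
    qed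
    moreover have "(\<lambda>z. of_real t * f z) holomorphic_on ball 0 1"
      by (intro holomorphic_intros holf)
    moreover have "deriv (\<lambda>z. of_real t * f z) a = of_real t * deriv f a"
      by (rule deriv_cmult) (use holf a in \<open>auto simp: holomorphic_on_imp_differentiable_at\<close>)
    ultimately show ?thesis
      using Schwarz_Pick_deriv_strict[of "\<lambda>z. of_real t * f z" a] a t
      by (simp add: norm_mult power_mult_distrib)
  qed
  have "((\<lambda>t. 1 - t\<^sup>2 * (norm (f a))\<^sup>2) \<longlongrightarrow> 1 - 1\<^sup>2 * (norm (f a))\<^sup>2) (at_left (1::real))"
    by (intro tendsto_intros)
  moreover have "((\<lambda>t. t * norm (deriv f a) * (1 - (norm a)\<^sup>2)) \<longlongrightarrow>
          1 * norm (deriv f a) * (1 - (norm a)\<^sup>2)) (at_left (1::real))"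
    by (intro tendsto_intros)
  moreover have "eventually (\<lambda>t. t * norm (deriv f a) * (1 - (norm a)\<^sup>2)
                    \<le> 1 - t\<^sup>2 * (norm (f a))\<^sup>2) (at_left (1::real))"
    using eventually_at_left_real[OF zero_less_one] by eventually_elim (use * in auto)
  ultimately have "1 * norm (deriv f a) * (1 - (norm a)\<^sup>2) \<le> 1 - 1\<^sup>2 * (norm (f a))\<^sup>2"
    by (rule tendsto_le[OF trivial_limit_at_left_real])
  thus ?thesis by simp
qed

section \<open>Logarithmic derivatives of functions with positive real part\<close>

text \<open>
  This is the logarithmic derivative taken with the Euler operator \<open>z d/dz\<close>. That operator
  commutes with the dilations \<open>z \<mapsto> r z\<close>, which makes it the natural one for radius problems.
\<close>
definition euler_log_deriv :: "(complex \<Rightarrow> complex) \<Rightarrow> complex \<Rightarrow> complex" where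
  "euler_log_deriv q z = z * deriv q z / q z"

lemma euler_log_deriv_mult:
  assumes "p holomorphic_on ball 0 1" "q holomorphic_on ball 0 1" "norm z < 1" "p z \<noteq> 0" "q z \<noteq> 0"
  shows "euler_log_deriv (\<lambda>z. p z * q z) z = euler_log_deriv p z + euler_log_deriv q z"
proof -
  have "deriv (\<lambda>z. p z * q z) z = p z * deriv q z + deriv p z * q z"
    by (rule deriv_mult) (use assms in \<open>auto simp: holomorphic_on_imp_differentiable_at\<close>)
  thus ?thesis using assms(4,5) by (simp add: euler_log_deriv_def field_simps)
qed

lemma class_PD:
  assumes "p \<in> class_P"
  shows "p holomorphic_on ball 0 1" "p 0 = 1" "norm z < 1 \<Longrightarrow> Re (p z) > 0" "norm z < 1 \<Longrightarrow> p z \<noteq> 0"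
  using assms by (force simp: class_P_def)+

text \<open>
  The Cayley transform \<open>w = (p - 1) / (p + 1)\<close> maps the right half-plane to the disc. With
  \<open>w' = 2 p' / (p + 1)\<^sup>2\<close> and \<open>1 - |w|\<^sup>2 = 4 Re p / |p + 1|\<^sup>2\<close> the Schwarz--Pick inequality
  for \<open>w\<close> becomes the stated one after cancelling \<open>|p + 1|\<^sup>2\<close>.
\<close>
lemma class_P_norm_deriv_le:
  assumes p: "p \<in> class_P" and a: "norm a < 1"
  shows "norm (deriv p a) * (1 - (norm a)\<^sup>2) \<le> 2 * Re (p a)"
proof -
  define w where "w = (\<lambda>z. (p z - 1) / (p z + 1))"
  note P = class_PD[OF p]
  have nz: "p z + 1 \<noteq> 0" if "norm z < 1" for z
    using P(3)[OF that] by (auto simp: complex_eq_iff)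
  have diff: "(norm (u + 1))\<^sup>2 - (norm (u - 1))\<^sup>2 = 4 * Re u" for u
    unfolding cmod_power2 by (simp add: power2_eq_square algebra_simps)
  have "norm (p z - 1) < norm (p z + 1)" if "norm z < 1" for z
  proof (rule power2_less_imp_less)
    show "(norm (p z - 1))\<^sup>2 < (norm (p z + 1))\<^sup>2"
      using P(3)[OF that] diff[of "p z"] by linarith
  qed simp
  hence "norm (w z) < 1" if "norm z < 1" for z
    using that nz[OF that] by (simp add: w_def norm_divide)
  moreover have "w holomorphic_on ball 0 1"
    unfolding w_def using nz by (intro holomorphic_intros P(1)) auto
  ultimately have SP: "norm (deriv w a) * (1 - (norm a)\<^sup>2) \<le> 1 - (norm (w a))\<^sup>2"
    using Schwarz_Pick_deriv_strict a by blast
  have "(p has_field_derivative deriv p a) (at a)"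
    using P(1) a by (simp add: holomorphic_derivI[where S = "ball 0 1"])
  hence "(w has_field_derivative 2 * deriv p a / (p a + 1)\<^sup>2) (at a)"
    unfolding w_def using nz[OF a]
    by (auto intro!: derivative_eq_intros simp: power2_eq_square divide_simps) (simp add: algebra_simps)
  hence "deriv w a = 2 * deriv p a / (p a + 1)\<^sup>2"
    by (rule DERIV_imp_deriv)
  hence 1: "norm (deriv w a) = 2 * norm (deriv p a) / (norm (p a + 1))\<^sup>2"
    by (simp add: norm_divide norm_mult norm_power)
  have pos: "(norm (p a + 1))\<^sup>2 > 0" using nz[OF a] by simp
  have 2: "1 - (norm (w a))\<^sup>2 = 4 * Re (p a) / (norm (p a + 1))\<^sup>2"
    unfolding diff[of "p a", symmetric] using pos nz[OF a]
    by (simp add: w_def norm_divide power_divide field_simps)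
  from SP pos show ?thesis unfolding 1 2 by (simp add: divide_simps)
qed

lemma class_P_euler_log_deriv_ge:
  assumes p: "p \<in> class_P" and a: "norm a < 1"
  shows "Re (euler_log_deriv p a) \<ge> - (2 * norm a / (1 - (norm a)\<^sup>2))"
proof -
  have k: "1 - (norm a)\<^sup>2 > 0" using a by (simp add: power_less_one_iff)
  have pp: "norm (p a) > 0" using class_PD(4)[OF p a] by simp
  have "norm (deriv p a) * (1 - (norm a)\<^sup>2) \<le> 2 * norm (p a)"
    using class_P_norm_deriv_le[OF p a] complex_Re_le_cmod[of "p a"] by linarith
  hence "norm (deriv p a) / norm (p a) \<le> 2 / (1 - (norm a)\<^sup>2)"
    using k pp by (simp add: divide_simps mult.commute)
  hence "norm a * (norm (deriv p a) / norm (p a)) \<le> norm a * (2 / (1 - (norm a)\<^sup>2))"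
    by (intro mult_left_mono) auto
  hence "norm (euler_log_deriv p a) \<le> 2 * norm a / (1 - (norm a)\<^sup>2)"
    by (simp add: euler_log_deriv_def norm_mult norm_divide mult.commute)
  thus ?thesis using abs_Re_le_cmod[of "euler_log_deriv p a"] by linarith
qed

text \<open>
  This is the extremal problem behind \<open>class_P_half_euler_log_deriv_ge\<close>, with \<open>r = |a|\<close>,
  \<open>x = Re (p a)\<close>, \<open>\<rho> = |p a|\<close> and \<open>T\<close> the modulus of the term that involves \<open>\<phi>'\<close>. After
  multiplication by \<open>\<rho> (1 - r\<^sup>2)\<close> the claim is affine in \<open>x\<close> with a nonpositive coefficient,
  so the worst case is \<open>x = \<rho>\<close>; there it factors as
  \<open>(\<rho> (1 + r) - 1) (2 \<rho> (1 - r) - 1) \<ge> 0\<close>. The values of \<open>p\<close> satisfy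
  \<open>\<rho> \<ge> 1 / (1 + r)\<close>, so the second factor is nonnegative as soon as \<open>2 (1 - r) \<ge> 1 + r\<close>,
  that is, \<open>r \<le> 1/3\<close>.
\<close>
lemma half_plane_real_estimate:
  fixes r \<rho> x T :: real
  assumes r: "0 \<le> r" "r \<le> 1/3" and \<rho>: "0 < \<rho>" "x \<le> \<rho>"
    and disc: "1 - 2 * x + \<rho>\<^sup>2 \<le> r\<^sup>2 * \<rho>\<^sup>2"
    and T: "T * \<rho> * (1 - r\<^sup>2) \<le> r\<^sup>2 * \<rho>\<^sup>2 - (1 - 2 * x + \<rho>\<^sup>2)"
  shows "x - 1 - T \<ge> - (r / (1 + r))"
proof -
  have k: "1 - r\<^sup>2 = (1 - r) * (1 + r)" by (simp add: power2_eq_square algebra_simps)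
  have kpos: "1 - r\<^sup>2 > 0" unfolding k using r by simp
  have "(1 - \<rho>)\<^sup>2 \<le> (r * \<rho>)\<^sup>2"
    using disc \<rho> by (simp add: power2_eq_square algebra_simps)
  hence "\<bar>1 - \<rho>\<bar> \<le> r * \<rho>" using r \<rho> by (simp add: abs_le_square_iff[symmetric])
  hence lo: "1 \<le> \<rho> * (1 + r)" and hi: "\<rho> * (1 - r) \<le> 1" by (simp_all add: algebra_simps abs_le_iff)
  have half: "1 \<le> 2 * (\<rho> * (1 - r))"
  proof -
    have "\<rho> * (1 + r) \<le> \<rho> * (2 * (1 - r))" using r \<rho> by (intro mult_left_mono) auto
    thus ?thesis using lo by linarith
  qed
  have "\<rho> * (1 - r\<^sup>2) \<le> 1 * (1 + r)"
    unfolding k mult.assoc[symmetric] using hi r by (intro mult_right_mono) auto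
  hence "(\<rho> - x) * (2 - \<rho> * (1 - r\<^sup>2)) \<ge> 0" using r \<rho> by (intro mult_nonneg_nonneg) auto
  moreover have "(\<rho> * (1 + r) - 1) * (2 * (\<rho> * (1 - r)) - 1) \<ge> 0"
    using lo half by (intro mult_nonneg_nonneg) auto
  ultimately have "x * \<rho> * (1 - r\<^sup>2) - \<rho> * (1 - r) - (2 * x - 1 - \<rho>\<^sup>2 * (1 - r\<^sup>2)) \<ge> 0"
    by (simp add: power2_eq_square algebra_simps)
  hence "T * \<rho> * (1 - r\<^sup>2) \<le> x * \<rho> * (1 - r\<^sup>2) - \<rho> * (1 - r)"
    using T by (simp add: algebra_simps)
  also have "\<dots> = (x - 1 / (1 + r)) * (\<rho> * (1 - r\<^sup>2))"
    unfolding k using r by (simp add: field_simps)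
  finally have "T * (\<rho> * (1 - r\<^sup>2)) \<le> (x - 1 / (1 + r)) * (\<rho> * (1 - r\<^sup>2))"
    by (simp add: mult.assoc)
  hence "T \<le> x - 1 / (1 + r)"
    by (rule mult_right_le_imp_le) (use \<rho> kpos in simp)
  moreover have "1 - r / (1 + r) = 1 / (1 + r)" using r by (simp add: field_simps)
  ultimately show ?thesis by linarith
qed

text \<open>
  With \<open>p = 1 / (1 + z \<phi>)\<close> one finds \<open>E p = p - 1 - z\<^sup>2 \<phi>' p\<close>. The main part \<open>p - 1\<close> is kept
  exactly and only the last term is estimated by its modulus, through the Schwarz--Pick
  inequality for \<open>\<phi>\<close>. Estimating all of \<open>E p\<close> by its modulus would lose the sharp constant.
\<close>
lemma class_P_half_euler_log_deriv_ge:
  assumes p: "p \<in> class_P_ord (1/2)" and a: "norm a \<le> 1/3"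
  shows "Re (euler_log_deriv p a) \<ge> - (norm a / (1 + norm a))"
proof -
  have pP: "p \<in> class_P" and half: "\<And>z. norm z < 1 \<Longrightarrow> Re (p z) > 1/2"
    using p by (auto simp: class_P_ord_def)
  note P = class_PD[OF pP]
  have a1: "norm a < 1" using a by simp
  define w where "w = (\<lambda>z. 1 / p z - 1)"
  have holw: "w holomorphic_on ball 0 1"
    unfolding w_def using P(4) by (intro holomorphic_intros P(1)) auto
  have w0: "w 0 = 0" by (simp add: w_def P(2))
  have nw: "norm (w z) = norm (1 - p z) / norm (p z)" if "norm z < 1" for z
    using P(4)[OF that] by (simp add: w_def norm_divide[symmetric] diff_divide_distrib)
  have sq: "(norm (1 - u))\<^sup>2 = 1 - 2 * Re u + (norm u)\<^sup>2" for u
    unfolding cmod_power2 by (simp add: power2_eq_square algebra_simps)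
  have w1: "norm (w z) < 1" if z: "norm z < 1" for z
  proof -
    have "norm (1 - p z) < norm (p z)"
    proof (rule power2_less_imp_less)
      show "(norm (1 - p z))\<^sup>2 < (norm (p z))\<^sup>2"
        using half[OF z] sq[of "p z"] by linarith
    qed simp
    thus ?thesis using P(4)[OF z] by (simp add: nw[OF z])
  qed
  obtain \<phi> where hol\<phi>: "\<phi> holomorphic_on ball 0 1"
    and w\<phi>: "\<And>z. norm z < 1 \<Longrightarrow> w z = z * \<phi> z" and w'0: "deriv w 0 = \<phi> 0"
    using Schwarz3[OF holw w0] by metis
  have \<phi>1: "norm (\<phi> z) \<le> 1" if z: "norm z < 1" for z
  proof (cases "z = 0")
    case True
    thus ?thesis using Schwarz_Lemma(2)[OF holw w0 w1 z] w'0 by simp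
  next
    case False
    thus ?thesis using Schwarz_Lemma(1)[OF holw w0 w1 z] w\<phi>[OF z] by (simp add: norm_mult)
  qed
  have pinv: "p z = inverse (1 + z * \<phi> z)" if "z \<in> ball 0 1" for z
  proof -
    have "p z * (1 + z * \<phi> z) = 1"
      using w\<phi>[of z] P(4)[of z] that by (simp add: w_def field_simps)
    thus ?thesis by (metis inverse_unique mult.commute)
  qed
  have nz: "1 + a * \<phi> a \<noteq> 0"
    using pinv[of a] P(4)[OF a1] a1 by auto
  have "(\<phi> has_field_derivative deriv \<phi> a) (at a)"
    using hol\<phi> a1 by (simp add: holomorphic_derivI[where S = "ball 0 1"])
  hence "((\<lambda>z. inverse (1 + z * \<phi> z)) has_field_derivative
           - (\<phi> a + a * deriv \<phi> a) * (p a)\<^sup>2) (at a)"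
    using nz pinv[of a] a1
    by (auto intro!: derivative_eq_intros simp: power2_eq_square) (simp add: algebra_simps)
  hence "(p has_field_derivative - (\<phi> a + a * deriv \<phi> a) * (p a)\<^sup>2) (at a)"
    by (rule has_field_derivative_transform_within_open[where S = "ball 0 1"]) (use a1 pinv in auto)
  hence p': "deriv p a = - (\<phi> a + a * deriv \<phi> a) * (p a)\<^sup>2"
    by (rule DERIV_imp_deriv)
  have "euler_log_deriv p a = - (a * \<phi> a * p a) - a\<^sup>2 * deriv \<phi> a * p a"
    unfolding euler_log_deriv_def p'
    using P(4)[OF a1] by (simp add: power2_eq_square field_simps)
  also have "a * \<phi> a * p a = 1 - p a"
    using w\<phi>[OF a1] P(4)[OF a1] by (simp add: w_def field_simps)
  finally have E: "euler_log_deriv p a = p a - 1 - a\<^sup>2 * deriv \<phi> a * p a" by simp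
  define T where "T = norm (a\<^sup>2 * deriv \<phi> a * p a)"
  have "Re (p a) - 1 - T \<ge> - (norm a / (1 + norm a))"
  proof (rule half_plane_real_estimate[where \<rho> = "norm (p a)"])
    have "norm (1 - p a) \<le> norm a * norm (p a)"
      using Schwarz_Lemma(1)[OF holw w0 w1 a1] P(4)[OF a1] nw[OF a1] by (simp add: divide_simps)
    hence "(norm (1 - p a))\<^sup>2 \<le> (norm a * norm (p a))\<^sup>2"
      by (intro power_mono) auto
    thus "1 - 2 * Re (p a) + (norm (p a))\<^sup>2 \<le> (norm a)\<^sup>2 * (norm (p a))\<^sup>2"
      by (simp add: sq power_mult_distrib)
    have n1: "norm (1 - p a) = norm a * norm (\<phi> a) * norm (p a)"
      using \<open>a * \<phi> a * p a = 1 - p a\<close> by (metis norm_mult)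
    have "(norm a)\<^sup>2 * (norm (p a))\<^sup>2 * (norm (deriv \<phi> a) * (1 - (norm a)\<^sup>2))
            \<le> (norm a)\<^sup>2 * (norm (p a))\<^sup>2 * (1 - (norm (\<phi> a))\<^sup>2)"
      by (intro mult_left_mono Schwarz_Pick_deriv hol\<phi> \<phi>1 a1) auto
    also have "\<dots> = (norm a)\<^sup>2 * (norm (p a))\<^sup>2 - (norm (1 - p a))\<^sup>2"
      unfolding n1 by (simp add: algebra_simps power2_eq_square)
    finally show "T * norm (p a) * (1 - (norm a)\<^sup>2)
        \<le> (norm a)\<^sup>2 * (norm (p a))\<^sup>2 - (1 - 2 * Re (p a) + (norm (p a))\<^sup>2)"
      unfolding T_def sq by (simp add: norm_mult norm_power power2_eq_square mult_ac)
  qed (use a P(4)[OF a1] complex_Re_le_cmod in auto)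
  moreover have "Re (a\<^sup>2 * deriv \<phi> a * p a) \<le> T"
    unfolding T_def by (rule complex_Re_le_cmod)
  ultimately show ?thesis unfolding E by simp
qed

section \<open>Quotients with removable singularities\<close>

lemma remove_sings_eq_holomorphic:
  assumes "open S" "h holomorphic_on S" "z \<in> S" "\<And>w. w \<in> S - {c} \<Longrightarrow> f w = h w"
  shows "remove_sings f z = h z"
proof -
  have "eventually (\<lambda>w. w \<in> S - {c} - {z}) (at z)"
  proof (cases "z = c")
    case True
    thus ?thesis using eventually_at_in_open[OF assms(1,3)] by simp
  next
    case False
    thus ?thesis
      using eventually_at_in_open[of "S - {c}" z] assms(1,3) by (auto simp: open_delete)
  qed
  hence "remove_sings f z = remove_sings h z"
    by (intro remove_sings_cong) (auto elim!: eventually_mono simp: assms(4))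
  also have "\<dots> = h z"
    using assms(1-3) by (intro remove_sings_at_analytic) (auto simp: analytic_at)
  finally show ?thesis .
qed

text \<open>
  The zeros of \<open>h\<close> need no local analysis: both sides are holomorphic on the disc and agree on
  the nonempty open set where \<open>h\<close> does not vanish, so they agree everywhere by the identity
  theorem.
\<close>
lemma eq_mult_remove_sings_divide:
  assumes f: "f holomorphic_on ball 0 1" and h: "h holomorphic_on ball 0 1"
    and q: "remove_sings (\<lambda>z. f z / h z) holomorphic_on ball 0 1"
    and a: "a \<in> ball 0 1" "h a \<noteq> 0" and z: "z \<in> ball 0 1"
  shows "f z = remove_sings (\<lambda>z. f z / h z) z * h z"
proof (rule analytic_continuation_open[where f = f and g = "\<lambda>z. remove_sings (\<lambda>z. f z / h z) z * h z" and
      s = "ball 0 1 \<inter> h -` (- {0})" and s' = "ball 0 1"])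
  show op: "open (ball 0 1 \<inter> h -` (- {0}))"
    by (intro continuous_open_preimage holomorphic_on_imp_continuous_on h) auto
  show "ball 0 1 \<inter> h -` (- {0}) \<noteq> {}" using a by auto
  show "f w = remove_sings (\<lambda>z. f z / h z) w * h w" if w: "w \<in> ball 0 1 \<inter> h -` (- {0})" for w
  proof -
    have "(\<lambda>z. f z / h z) holomorphic_on ball 0 1 \<inter> h -` (- {0})"
      by (intro holomorphic_intros holomorphic_on_subset[OF f] holomorphic_on_subset[OF h]) auto
    hence "remove_sings (\<lambda>z. f z / h z) w = f w / h w"
      using w op by (intro remove_sings_at_analytic) (auto simp: analytic_at)
    thus ?thesis using w by simp
  qed
qed (use z in \<open>auto intro!: holomorphic_intros f h q\<close>)

lemma class_AD:
  assumes "f \<in> class_A"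
  shows "f holomorphic_on ball 0 1" "f 0 = 0" "deriv f 0 = 1"
  using assms by (auto simp: class_A_def)

lemma class_A_nonzero_point:
  assumes "f \<in> class_A"
  obtains a where "a \<in> ball 0 1" "f a \<noteq> 0"
proof -
  have "\<exists>a\<in>ball 0 1. f a \<noteq> 0"
  proof (rule ccontr)
    assume "\<not> ?thesis"
    hence "deriv f 0 = deriv (\<lambda>_. 0) (0::complex)"
    by (intro deriv_cong_ev eventually_mono[OF eventually_nhds_in_open[of "ball 0 1"]]) auto
    thus False using class_AD(3)[OF assms] by simp
  qed
  thus ?thesis using that by blast
qed

lemma class_A_id_mult:
  assumes "q holomorphic_on ball 0 1" "q 0 = 1"
  shows "(\<lambda>z. z * q z) \<in> class_A"
proof -
  have "deriv (\<lambda>z. z * q z) 0 = 0 * deriv q 0 + deriv (\<lambda>z. z) 0 * q 0"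
    by (rule deriv_mult) (use assms in \<open>auto simp: holomorphic_on_imp_differentiable_at\<close>)
  thus ?thesis using assms by (auto simp: class_A_def intro!: holomorphic_intros)
qed

text \<open>
  This lets one factorization lemma serve the first two classes, which differ only in the bound
  on the real part of the middle factor.
\<close>
lemma class_P_eq_class_P_ord_0: "class_P = class_P_ord 0"
  by (auto simp: class_P_ord_def class_P_def)

lemma class_P_ord_cong:
  assumes "q \<in> class_P_ord \<beta>" "\<And>z. z \<in> ball 0 1 \<Longrightarrow> p z = q z"
  shows "p \<in> class_P_ord \<beta>"
proof -
  have "p holomorphic_on ball 0 1 \<longleftrightarrow> q holomorphic_on ball 0 1"
    using assms(2) by (intro holomorphic_cong) auto
  thus ?thesis using assms by (auto simp: class_P_ord_def class_P_def)
qed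

text \<open>
  The factors are the two filled-in quotients and \<open>p\<close> itself. Conversely, a factorization
  determines the intermediate function \<open>g(z) = z p2(z) p3(z)\<close>, whose only zero in the disc is
  the origin.
\<close>
lemma double_quotient_iff_factorization:
  assumes f: "f \<in> class_A"
  shows "(\<exists>g\<in>class_A. \<exists>p\<in>class_P. remove_sings (\<lambda>z. f z / g z) \<in> class_P \<and>
            remove_sings (\<lambda>z. g z / (z * p z)) \<in> class_P_ord \<beta>) \<longleftrightarrow>
         (\<exists>p1\<in>class_P. \<exists>p2\<in>class_P_ord \<beta>. \<exists>p3\<in>class_P.
            \<forall>z\<in>ball 0 1. f z = z * (p1 z * p2 z * p3 z))" (is "?L \<longleftrightarrow> ?R")
proof
  assume ?L
  then obtain g p where g: "g \<in> class_A" and p: "p \<in> class_P"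
    and p1: "remove_sings (\<lambda>z. f z / g z) \<in> class_P" (is "?p1 \<in> _")
    and p2: "remove_sings (\<lambda>z. g z / (z * p z)) \<in> class_P_ord \<beta>" (is "?p2 \<in> _") by auto
  obtain a where a: "a \<in> ball 0 1" "g a \<noteq> 0" by (rule class_A_nonzero_point[OF g])
  have p2': "?p2 \<in> class_P" using p2 by (simp add: class_P_ord_def)
  \<comment> \<open>The identity theorem needs one point where \<open>z p(z)\<close> does not vanish; any point other than
    the origin will do.\<close>
  have half: "(1/2::complex) \<in> ball 0 1" "1/2 * p (1/2) \<noteq> 0" using class_PD(4)[OF p] by auto
  have "f z = z * (?p1 z * ?p2 z * p z)" if z: "z \<in> ball 0 1" for z
  proof -
    have "f z = ?p1 z * g z"
      using eq_mult_remove_sings_divide[OF class_AD(1)[OF f] class_AD(1)[OF g] class_PD(1)[OF p1] a z] .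
    also have "g z = ?p2 z * (z * p z)"
      by (rule eq_mult_remove_sings_divide[OF class_AD(1)[OF g] _ class_PD(1)[OF p2'] half z])
         (intro holomorphic_intros class_PD(1)[OF p])
    finally show ?thesis by (simp only: mult_ac)
  qed
  thus ?R using p1 p2 p by blast
next
  assume ?R
  then obtain p1 p2 p3 where p1: "p1 \<in> class_P" and p2: "p2 \<in> class_P_ord \<beta>" and p3: "p3 \<in> class_P"
    and fz: "\<And>z. z \<in> ball 0 1 \<Longrightarrow> f z = z * (p1 z * p2 z * p3 z)" by blast
  have p2': "p2 \<in> class_P" using p2 by (simp add: class_P_ord_def)
  define g where "g = (\<lambda>z. z * (p2 z * p3 z))"
  have "g \<in> class_A"
    unfolding g_def
    by (intro class_A_id_mult holomorphic_intros class_PD(1) p2' p3)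
       (simp add: class_PD(2)[OF p2'] class_PD(2)[OF p3])
  moreover have "remove_sings (\<lambda>z. f z / g z) z = p1 z" if "z \<in> ball 0 1" for z
    by (rule remove_sings_eq_holomorphic[where S = "ball 0 1" and c = 0])
       (use that fz class_PD(4)[OF p2'] class_PD(4)[OF p3] in \<open>auto simp: g_def class_PD(1)[OF p1]\<close>)
  hence "remove_sings (\<lambda>z. f z / g z) \<in> class_P"
    using class_P_ord_cong p1 unfolding class_P_eq_class_P_ord_0 by blast
  moreover have "remove_sings (\<lambda>z. g z / (z * p3 z)) z = p2 z" if "z \<in> ball 0 1" for z
    by (rule remove_sings_eq_holomorphic[where S = "ball 0 1" and c = 0])
       (use that class_PD(4)[OF p3] in \<open>auto simp: g_def class_PD(1)[OF p2']\<close>)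
  hence "remove_sings (\<lambda>z. g z / (z * p3 z)) \<in> class_P_ord \<beta>"
    using class_P_ord_cong p2 by blast
  ultimately show ?L using p3 by blast
qed

lemma single_quotient_iff_factorization:
  assumes f: "f \<in> class_A"
  shows "(\<exists>p\<in>class_P. remove_sings (\<lambda>z. f z / (z * p z)) \<in> class_P) \<longleftrightarrow>
         (\<exists>p1\<in>class_P. \<exists>p2\<in>class_P. \<forall>z\<in>ball 0 1. f z = z * (p1 z * p2 z))" (is "?L \<longleftrightarrow> ?R")
proof
  assume ?L
  then obtain p where p: "p \<in> class_P"
    and p1: "remove_sings (\<lambda>z. f z / (z * p z)) \<in> class_P" (is "?p1 \<in> _") by auto
  \<comment> \<open>The identity theorem needs one point where \<open>z p(z)\<close> does not vanish; any point other than
    the origin will do.\<close>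
  have half: "(1/2::complex) \<in> ball 0 1" "1/2 * p (1/2) \<noteq> 0" using class_PD(4)[OF p] by auto
  have "f z = z * (?p1 z * p z)" if z: "z \<in> ball 0 1" for z
  proof -
    have "f z = ?p1 z * (z * p z)"
      by (rule eq_mult_remove_sings_divide[OF class_AD(1)[OF f] _ class_PD(1)[OF p1] half z])
         (intro holomorphic_intros class_PD(1)[OF p])
    thus ?thesis by (simp only: mult_ac)
  qed
  thus ?R using p1 p by blast
next
  assume ?R
  then obtain p1 p2 where p1: "p1 \<in> class_P" and p2: "p2 \<in> class_P"
    and fz: "\<And>z. z \<in> ball 0 1 \<Longrightarrow> f z = z * (p1 z * p2 z)" by blast
  have "remove_sings (\<lambda>z. f z / (z * p2 z)) z = p1 z" if "z \<in> ball 0 1" for z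
    by (rule remove_sings_eq_holomorphic[where S = "ball 0 1" and c = 0])
       (use that fz class_PD(4)[OF p2] in \<open>auto simp: class_PD(1)[OF p1]\<close>)
  hence "remove_sings (\<lambda>z. f z / (z * p2 z)) \<in> class_P"
    using class_P_ord_cong p1 unfolding class_P_eq_class_P_ord_0 by blast
  thus ?L using p2 by blast
qed

lemma class_G1_iff:
  "f \<in> class_G1 \<longleftrightarrow> f \<in> class_A \<and> (\<exists>p1\<in>class_P. \<exists>p2\<in>class_P. \<exists>p3\<in>class_P.
     \<forall>z\<in>ball 0 1. f z = z * (p1 z * p2 z * p3 z))"
  using double_quotient_iff_factorization[of f 0]
  unfolding class_G1_def class_P_eq_class_P_ord_0[symmetric] by blast

lemma class_G2_iff:
  "f \<in> class_G2 \<longleftrightarrow> f \<in> class_A \<and> (\<exists>p1\<in>class_P. \<exists>p2\<in>class_P_ord (1/2). \<exists>p3\<in>class_P.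
     \<forall>z\<in>ball 0 1. f z = z * (p1 z * p2 z * p3 z))"
  using double_quotient_iff_factorization[of f "1/2"] unfolding class_G2_def by blast

lemma class_G3_iff:
  "f \<in> class_G3 \<longleftrightarrow> f \<in> class_A \<and> (\<exists>p1\<in>class_P. \<exists>p2\<in>class_P.
     \<forall>z\<in>ball 0 1. f z = z * (p1 z * p2 z))"
  using single_quotient_iff_factorization[of f] unfolding class_G3_def by blast

section \<open>The starlikeness radius in terms of logarithmic derivatives\<close>

text \<open>
  The factor \<open>q\<close> represents \<open>f(z) / z\<close>, with the singularity at the origin filled in.
\<close>
definition zero_free_factor :: "(complex \<Rightarrow> complex) \<Rightarrow> (complex \<Rightarrow> complex) \<Rightarrow> bool" where
  "zero_free_factor f q \<longleftrightarrow> q holomorphic_on ball 0 1 \<and> (\<forall>z\<in>ball 0 1. q z \<noteq> 0 \<and> f z = z * q z)"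

text \<open>
  For \<open>F(z) = f(r z) / r\<close> one has \<open>z F'(z) / F(z) = 1 + E q (r z)\<close> away from the origin, and
  the right-hand side is holomorphic on the disc because \<open>q\<close> has no zeros. It is therefore the
  filled-in quotient, and \<open>r z\<close> runs through all \<open>w\<close> with \<open>|w| < r\<close>.
\<close>
lemma starlike_ord_dilation_iff:
  assumes f: "f \<in> class_A" and q: "zero_free_factor f q" and r: "0 < r" "r < 1"
  shows "(\<lambda>z. f (of_real r * z) / of_real r) \<in> starlike_ord \<alpha> \<longleftrightarrow>
         (\<forall>w. norm w < r \<longrightarrow> \<alpha> < 1 + Re (euler_log_deriv q w))" (is "?F \<in> _ \<longleftrightarrow> _")
proof -
  have holq: "q holomorphic_on ball 0 1"
    and qnz: "\<And>z. norm z < 1 \<Longrightarrow> q z \<noteq> 0" and fq: "\<And>z. norm z < 1 \<Longrightarrow> f z = z * q z"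
    using q by (auto simp: zero_free_factor_def)
  have in_ball: "norm (of_real r * z) < 1" if "norm z < 1" for z :: complex
  proof -
    have "r * norm z < 1 * 1" using r that by (intro mult_strict_mono) auto
    thus ?thesis using r by (simp add: norm_mult)
  qed
  have dF: "(?F has_field_derivative deriv f (of_real r * z)) (at z)" if "norm z < 1" for z
  proof -
    have "(f has_field_derivative deriv f (of_real r * z)) (at (of_real r * z))"
      using class_AD(1)[OF f] in_ball[OF that]
      by (simp add: holomorphic_derivI[where S = "ball 0 1"])
    moreover have "((\<lambda>z. of_real r * z) has_field_derivative of_real r) (at z)"
      by (auto intro!: derivative_eq_intros)
    ultimately have "((\<lambda>z. f (of_real r * z)) has_field_derivative deriv f (of_real r * z) * of_real r) (at z)"
      by (rule DERIV_chain2)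
    from DERIV_cdivide[OF this, of "of_real r"] show ?thesis using r by simp
  qed
  have FA: "?F \<in> class_A"
  proof -
    have "?F holomorphic_on ball 0 1"
      unfolding holomorphic_on_open[OF open_ball] using dF by (meson mem_ball_0)
    moreover have "deriv ?F 0 = 1"
      using DERIV_imp_deriv[OF dF[of 0]] class_AD(3)[OF f] by simp
    ultimately show ?thesis using class_AD(2)[OF f] by (simp add: class_A_def)
  qed
  have df: "deriv f w = w * deriv q w + q w" if "norm w < 1" for w
  proof -
    have "(q has_field_derivative deriv q w) (at w)"
      using holq that by (simp add: holomorphic_derivI[where S = "ball 0 1"])
    hence "((\<lambda>z. z * q z) has_field_derivative w * deriv q w + q w) (at w)"
      by (auto intro!: derivative_eq_intros)
    hence "(f has_field_derivative w * deriv q w + q w) (at w)"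
      by (rule has_field_derivative_transform_within_open[where S = "ball 0 1"])
         (use that fq in auto)
    thus ?thesis by (rule DERIV_imp_deriv)
  qed
  define G where "G = (\<lambda>z. 1 + euler_log_deriv q (of_real r * z))"
  have holG: "G holomorphic_on ball 0 1"
  proof -
    have "(\<lambda>w. 1 + euler_log_deriv q w) holomorphic_on ball 0 1"
      unfolding euler_log_deriv_def using qnz by (intro holomorphic_intros holq) auto
    hence "(\<lambda>w. 1 + euler_log_deriv q w) \<circ> (\<lambda>z. of_real r * z) holomorphic_on ball 0 1"
      by (rule holomorphic_on_compose_gen[rotated]) (use in_ball in \<open>auto intro!: holomorphic_intros\<close>)
    thus ?thesis by (simp add: G_def o_def)
  qed
  have rs: "remove_sings (\<lambda>z. z * deriv ?F z / ?F z) z = G z" if "z \<in> ball 0 1" for z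
  proof (rule remove_sings_eq_holomorphic[where S = "ball 0 1" and c = 0])
    fix w :: complex assume w: "w \<in> ball 0 1 - {0}"
    define u where "u = of_real r * w"
    have u: "norm u < 1" "u \<noteq> 0" using in_ball[of w] w r by (auto simp: u_def)
    have "w * deriv ?F w / ?F w = u * deriv f u / f u"
      using DERIV_imp_deriv[OF dF[of w]] w r by (simp add: u_def)
    also have "\<dots> = 1 + euler_log_deriv q u"
      using u qnz[of u] by (simp add: fq df euler_log_deriv_def field_simps)
    finally show "w * deriv ?F w / ?F w = G w" by (simp add: G_def u_def)
  qed (use that holG in auto)
  have hol: "remove_sings (\<lambda>z. z * deriv ?F z / ?F z) holomorphic_on ball 0 1"
    by (rule holomorphic_transform[OF holG]) (rule rs[symmetric])
  have "?F \<in> starlike_ord \<alpha> \<longleftrightarrow> (\<forall>z\<in>ball 0 1. \<alpha> < Re (G z))"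
    using FA hol rs by (simp add: starlike_ord_def)
  also have "\<dots> \<longleftrightarrow> (\<forall>w. norm w < r \<longrightarrow> \<alpha> < 1 + Re (euler_log_deriv q w))"
  proof safe
    fix w :: complex assume *: "\<forall>z\<in>ball 0 1. \<alpha> < Re (G z)" and w: "norm w < r"
    have "w / of_real r \<in> ball 0 1" using w r by (simp add: norm_divide divide_simps)
    with * have "\<alpha> < Re (G (w / of_real r))" by blast
    thus "\<alpha> < 1 + Re (euler_log_deriv q w)" using r by (simp add: G_def)
  next
    fix z :: complex
    assume *: "\<forall>w. norm w < r \<longrightarrow> \<alpha> < 1 + Re (euler_log_deriv q w)" and z: "z \<in> ball 0 1"
    have "norm (of_real r * z) < r" using z r by (simp add: norm_mult)
    with * show "\<alpha> < Re (G z)" by (simp add: G_def)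
  qed
  finally show ?thesis .
qed

text \<open>
  Admissibility of \<open>R\<close> involves dilations by \<open>r < R\<close> only, so a bound that holds strictly
  inside the disc of radius \<open>R\<close> suffices. One function that violates it at a point of modulus
  exactly \<open>R\<close> excludes every larger radius, since that point then lies inside the disc of
  radius \<open>r\<close> for some dilation factor \<open>r\<close> between \<open>R\<close> and the larger radius.
\<close>
lemma has_class_radius_starlikeI:
  assumes R: "0 < R" "R < 1" and sub: "F \<subseteq> class_A"
    and bound: "\<And>f. f \<in> F \<Longrightarrow> \<exists>q. zero_free_factor f q \<and>
                  (\<forall>w. norm w < R \<longrightarrow> \<alpha> < 1 + Re (euler_log_deriv q w))"
    and ext: "f0 \<in> F" "zero_free_factor f0 q0" "norm w0 = R" "1 + Re (euler_log_deriv q0 w0) \<le> \<alpha>"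
  shows "has_class_radius (starlike_ord \<alpha>) F R"
  unfolding has_class_radius_def
proof safe
  show "radius_admissible (starlike_ord \<alpha>) F R"
    unfolding radius_admissible_def
  proof (intro conjI ballI allI impI R, elim conjE)
    fix f r assume f: "f \<in> F" and r: "0 < r" "r < R"
    from bound[OF f] obtain q where q: "zero_free_factor f q"
      and *: "\<forall>w. norm w < R \<longrightarrow> \<alpha> < 1 + Re (euler_log_deriv q w)" by blast
    have "\<forall>w. norm w < r \<longrightarrow> \<alpha> < 1 + Re (euler_log_deriv q w)"
      using * r by force
    thus "(\<lambda>z. f (of_real r * z) / of_real r) \<in> starlike_ord \<alpha>"
      using starlike_ord_dilation_iff[of f q r \<alpha>] f sub q r R by auto
  qed
next
  fix R' assume R': "radius_admissible (starlike_ord \<alpha>) F R'"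
  show "R' \<le> R"
  proof (rule ccontr)
    assume "\<not> R' \<le> R"
    then obtain r where r: "R < r" "r < R'" using dense[of R R'] by auto
    have "r < 1" using r R' by (simp add: radius_admissible_def)
    have "(\<lambda>z. f0 (of_real r * z) / of_real r) \<in> starlike_ord \<alpha>"
      using R' ext(1) r R(1) by (auto simp: radius_admissible_def)
    hence "\<alpha> < 1 + Re (euler_log_deriv q0 w0)"
      using starlike_ord_dilation_iff[of f0 q0 r \<alpha>] ext(1-3) sub r R(1) \<open>r < 1\<close> by auto
    thus False using ext(4) by simp
  qed
qed

section \<open>Extremal functions\<close>

lemma half_plane_map_class_P_ord_half: "(\<lambda>z. 1 / (1 - z)) \<in> class_P_ord (1/2)"
proof -
  have re: "Re (1 / (1 - z)) > 1/2" if z: "norm z < 1" for z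
  proof -
    have nz: "1 - z \<noteq> 0" using z by auto
    have "(norm z)\<^sup>2 < 1" using z by (simp add: power_less_one_iff)
    hence "(norm (1 - z))\<^sup>2 < 2 * Re (1 - z)"
      unfolding cmod_power2 by (simp add: power2_eq_square algebra_simps)
    moreover have "Re (1 / (1 - z)) = Re (1 - z) / (norm (1 - z))\<^sup>2"
      unfolding cmod_power2 by (simp add: Re_divide)
    moreover have "(norm (1 - z))\<^sup>2 > 0" using nz by simp
    ultimately show ?thesis by (simp add: pos_less_divide_eq del: Re_divide)
  qed
  have "(\<lambda>z. 1 / (1 - z)) holomorphic_on ball (0::complex) 1"
    by (intro holomorphic_intros) auto
  moreover have "Re (1 / (1 - z)) > 0" if "norm z < 1" for z
    using re[OF that] by linarith
  ultimately show ?thesis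
    using re by (auto simp: class_P_ord_def class_P_def simp del: Re_divide)
qed

lemma cayley_map_class_P: "(\<lambda>z. (1 + z) / (1 - z)) \<in> class_P"
proof -
  have "Re ((1 + z) / (1 - z)) > 0" if z: "norm z < 1" for z
  proof -
    have "1 - z \<noteq> 0" using z by auto
    hence "(1 + z) / (1 - z) = 2 * (1 / (1 - z)) - 1" by (simp add: field_simps)
    moreover have "Re (1 / (1 - z)) > 1/2"
      using half_plane_map_class_P_ord_half z by (simp add: class_P_ord_def del: Re_divide)
    moreover have "Re (2 * u - 1) = 2 * Re u - 1" for u by simp
    ultimately show ?thesis by (metis diff_gt_0_iff_gt divide_less_eq_numeral1(1) mult.commute)
  qed
  moreover have "(\<lambda>z. (1 + z) / (1 - z)) holomorphic_on ball (0::complex) 1"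
    by (intro holomorphic_intros) auto
  ultimately show ?thesis by (auto simp: class_P_def simp del: Re_divide)
qed

lemma euler_log_deriv_cayley_map:
  assumes "0 \<le> r" "r < 1"
  shows "euler_log_deriv (\<lambda>z. (1 + z) / (1 - z)) (- of_real r) = of_real (- (2 * r / (1 - r\<^sup>2)))"
proof -
  have nz: "1 + (of_real r :: complex) \<noteq> 0" "1 - (of_real r :: complex) \<noteq> 0"
    using assms by (auto simp: complex_eq_iff)
  have "((\<lambda>z. (1 + z) / (1 - z)) has_field_derivative 2 / (1 + of_real r)\<^sup>2) (at (- of_real r :: complex))"
    using nz by (auto intro!: derivative_eq_intros simp: power2_eq_square divide_simps)
  hence "deriv (\<lambda>z. (1 + z) / (1 - z)) (- of_real r :: complex) = 2 / (1 + of_real r)\<^sup>2"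
    by (rule DERIV_imp_deriv)
  moreover have "1 - (of_real r :: complex)\<^sup>2 = (1 + of_real r) * (1 - of_real r)"
    by (simp add: power2_eq_square algebra_simps)
  ultimately show ?thesis
    using nz by (simp add: euler_log_deriv_def power2_eq_square)
qed

lemma euler_log_deriv_half_plane_map:
  assumes "0 \<le> r" "r < 1"
  shows "euler_log_deriv (\<lambda>z. 1 / (1 - z)) (- of_real r) = of_real (- (r / (1 + r)))"
proof -
  have nz: "1 + (of_real r :: complex) \<noteq> 0"
    using assms by (auto simp: complex_eq_iff)
  have "((\<lambda>z. 1 / (1 - z)) has_field_derivative 1 / (1 + of_real r)\<^sup>2) (at (- of_real r :: complex))"
    using nz by (auto intro!: derivative_eq_intros simp: power2_eq_square divide_simps)
  hence "deriv (\<lambda>z. 1 / (1 - z)) (- of_real r :: complex) = 1 / (1 + of_real r)\<^sup>2"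
    by (rule DERIV_imp_deriv)
  thus ?thesis
    using nz by (simp add: euler_log_deriv_def power2_eq_square)
qed

section \<open>The radii\<close>

text \<open>
  The equation \<open>2 c r / (1 - r\<^sup>2) = b\<close> is \<open>b r\<^sup>2 + 2 c r - b = 0\<close>; the given form of its
  positive root is the usual one after rationalising the numerator. It occurs with
  \<open>b = 1 - \<alpha>\<close>, and with \<open>c = 3\<close> or \<open>c = 2\<close>, the number of factors of positive real part.
\<close>
lemma quadratic_root_pos_leading:
  fixes b c :: real
  assumes b: "0 < b" and c: "1 \<le> c"
  defines "R \<equiv> b / (c + sqrt (c\<^sup>2 + b\<^sup>2))"
  shows "0 < R" "R < 1" "2 * c * R / (1 - R\<^sup>2) = b"
    "0 \<le> r \<Longrightarrow> r < R \<Longrightarrow> 2 * c * r / (1 - r\<^sup>2) < b"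
proof -
  define s where "s = sqrt (c\<^sup>2 + b\<^sup>2)"
  have s2: "s\<^sup>2 = c\<^sup>2 + b\<^sup>2" by (simp add: s_def)
  have "b < s" unfolding s_def using b c by (intro real_less_rsqrt) simp
  hence cs: "b < c + s" "0 < c + s" using b c by linarith+
  show R: "0 < R" "R < 1" using b cs by (simp_all add: R_def s_def)
  have Rcs: "R * (c + s) = b" using cs by (simp add: R_def s_def)
  have "(b * R\<^sup>2 + 2 * c * R - b) * (c + s)\<^sup>2
          = b * (R * (c + s))\<^sup>2 + 2 * c * (R * (c + s)) * (c + s) - b * (c + s)\<^sup>2"
    by (simp add: power2_eq_square algebra_simps)
  also have "\<dots> = b * (b\<^sup>2 + c\<^sup>2 - s\<^sup>2)"
    unfolding Rcs by (simp add: power2_eq_square algebra_simps)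
  finally have quad: "b * R\<^sup>2 + 2 * c * R = b" using s2 cs by simp
  have lt1: "x\<^sup>2 < 1" if "0 \<le> x" "x \<le> R" for x
    using that R by (simp add: power_less_one_iff)
  show "2 * c * R / (1 - R\<^sup>2) = b"
    using lt1[of R] R quad by (simp add: divide_eq_eq algebra_simps)
  assume r: "0 \<le> r" "r < R"
  have "b * r\<^sup>2 \<le> b * R\<^sup>2" using b r by (intro mult_left_mono power_mono) auto
  moreover have "2 * c * r < 2 * c * R" using c r by simp
  ultimately have "2 * c * r < b * (1 - r\<^sup>2)" using quad by (simp add: algebra_simps)
  thus "2 * c * r / (1 - r\<^sup>2) < b" using lt1[of r] r by (simp add: divide_less_eq)
qed

text \<open>
  Over the common denominator \<open>1 - r\<^sup>2\<close> the equation becomes \<open>\<alpha> r\<^sup>2 - 5 r + (1 - \<alpha>) = 0\<close>.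
  The rationalised form of its smaller root remains meaningful for \<open>\<alpha> = 0\<close>, where the equation
  is linear. The bound \<open>R \<le> 1/3\<close> is what the sharp estimate for real part above \<open>1/2\<close>
  requires.
\<close>
lemma quadratic_root_class_G2:
  fixes \<alpha> :: real
  assumes \<alpha>: "0 \<le> \<alpha>" "\<alpha> < 1"
  defines "R \<equiv> 2 * (1 - \<alpha>) / (5 + sqrt (25 - 4 * \<alpha> + 4 * \<alpha>\<^sup>2))"
  shows "0 < R" "R \<le> 1/3" "4 * R / (1 - R\<^sup>2) + R / (1 + R) = 1 - \<alpha>"
    "0 \<le> r \<Longrightarrow> r < R \<Longrightarrow> 4 * r / (1 - r\<^sup>2) + r / (1 + r) < 1 - \<alpha>"
proof -
  define s where "s = sqrt (25 - 4 * \<alpha> + 4 * \<alpha>\<^sup>2)"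
  have ge: "25 - 4 * \<alpha> + 4 * \<alpha>\<^sup>2 \<ge> 16" using \<alpha> zero_le_power2[of \<alpha>] by linarith
  hence s2: "s\<^sup>2 = 25 - 4 * \<alpha> + 4 * \<alpha>\<^sup>2" by (simp add: s_def)
  have s: "4 \<le> s" unfolding s_def using ge by (intro real_le_rsqrt) simp
  show R: "0 < R" "R \<le> 1/3"
    unfolding R_def s_def[symmetric] using s \<alpha> by (simp_all add: divide_simps)
  have Rs: "R * (5 + s) = 2 * (1 - \<alpha>)" unfolding R_def s_def[symmetric] using s by simp
  have "(\<alpha> * R\<^sup>2 - 5 * R + (1 - \<alpha>)) * (5 + s)\<^sup>2
          = \<alpha> * (R * (5 + s))\<^sup>2 - 5 * (R * (5 + s)) * (5 + s) + (1 - \<alpha>) * (5 + s)\<^sup>2"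
    by (simp add: power2_eq_square algebra_simps)
  also have "\<dots> = (1 - \<alpha>) * (s\<^sup>2 - (25 - 4 * \<alpha> + 4 * \<alpha>\<^sup>2))"
    unfolding Rs by (simp add: power2_eq_square algebra_simps)
  finally have quad: "\<alpha> * R\<^sup>2 - 5 * R + (1 - \<alpha>) = 0" using s2 s by simp
  have combine: "4 * x / (1 - x\<^sup>2) + x / (1 + x) = (5 * x - x\<^sup>2) / (1 - x\<^sup>2)"
    and pos: "1 - x\<^sup>2 > 0" if "0 \<le> x" "x \<le> R" for x
  proof -
    have k: "1 - x\<^sup>2 = (1 + x) * (1 - x)" by (simp add: power2_eq_square algebra_simps)
    have nz: "1 + x > 0" "1 - x > 0" using that R by auto
    show "1 - x\<^sup>2 > 0" unfolding k using nz by simp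
    have "x / (1 + x) = x * (1 - x) / (1 - x\<^sup>2)" unfolding k using nz by simp
    thus "4 * x / (1 - x\<^sup>2) + x / (1 + x) = (5 * x - x\<^sup>2) / (1 - x\<^sup>2)"
      by (simp add: add_divide_distrib[symmetric] power2_eq_square algebra_simps)
  qed
  show "4 * R / (1 - R\<^sup>2) + R / (1 + R) = 1 - \<alpha>"
  proof -
    have "5 * R - R\<^sup>2 = (1 - \<alpha>) * (1 - R\<^sup>2)" using quad by (simp add: algebra_simps)
    thus ?thesis using combine[of R] pos[of R] R by simp
  qed
  assume r: "0 \<le> r" "r < R"
  \<comment> \<open>Subtracting the quadratic at \<open>R\<close>, where it vanishes, from the quadratic at \<open>r\<close> leaves
    \<open>(R - r) (5 - \<alpha> (R + r))\<close>.\<close>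
  have "\<alpha> * (R + r) \<le> 1 * 1" using \<alpha> r R by (intro mult_mono) auto
  hence "(R - r) * (5 - \<alpha> * (R + r)) > 0" using r by (intro mult_pos_pos) auto
  hence "5 * r - r\<^sup>2 < (1 - \<alpha>) * (1 - r\<^sup>2)"
    using quad by (simp add: power2_eq_square algebra_simps)
  thus "4 * r / (1 - r\<^sup>2) + r / (1 + r) < 1 - \<alpha>"
    using combine[of r] pos[of r] r by (simp add: divide_less_eq)
qed

lemma class_P_ord_imp_class_P: "p \<in> class_P_ord \<beta> \<Longrightarrow> p \<in> class_P"
  by (simp add: class_P_ord_def)

lemma zero_free_factor_class_P_mult:
  assumes "p \<in> class_P" "q \<in> class_P" "\<And>z. z \<in> ball 0 1 \<Longrightarrow> f z = z * (p z * q z)"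
  shows "zero_free_factor f (\<lambda>z. p z * q z)"
  using assms class_PD[OF assms(1)] class_PD[OF assms(2)]
  by (auto simp: zero_free_factor_def intro!: holomorphic_intros)

lemma zero_free_factor_class_P_mult3:
  assumes "p1 \<in> class_P" "p2 \<in> class_P" "p3 \<in> class_P"
    "\<And>z. z \<in> ball 0 1 \<Longrightarrow> f z = z * (p1 z * p2 z * p3 z)"
  shows "zero_free_factor f (\<lambda>z. p1 z * p2 z * p3 z)"
  using assms class_PD[OF assms(1)] class_PD[OF assms(2)] class_PD[OF assms(3)]
  by (auto simp: zero_free_factor_def intro!: holomorphic_intros)

lemma euler_log_deriv_class_P_mult:
  assumes "p \<in> class_P" "q \<in> class_P" "norm z < 1"
  shows "euler_log_deriv (\<lambda>z. p z * q z) z = euler_log_deriv p z + euler_log_deriv q z"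
  using assms by (intro euler_log_deriv_mult class_PD)

lemma euler_log_deriv_class_P_mult3:
  assumes "p1 \<in> class_P" "p2 \<in> class_P" "p3 \<in> class_P" "norm z < 1"
  shows "euler_log_deriv (\<lambda>z. p1 z * p2 z * p3 z) z =
           euler_log_deriv p1 z + euler_log_deriv p2 z + euler_log_deriv p3 z"
proof -
  have "euler_log_deriv (\<lambda>z. p1 z * p2 z * p3 z) z
      = euler_log_deriv (\<lambda>z. p1 z * p2 z) z + euler_log_deriv p3 z"
    by (rule euler_log_deriv_mult[where p = "\<lambda>z. p1 z * p2 z"])
       (use assms class_PD in \<open>auto intro!: holomorphic_intros\<close>)
  thus ?thesis using assms by (simp add: euler_log_deriv_class_P_mult)
qed

abbreviation "cayley_map \<equiv> (\<lambda>z::complex. (1 + z) / (1 - z))"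

abbreviation "half_plane_map \<equiv> (\<lambda>z::complex. 1 / (1 - z))"

text \<open>
  The bound is attained by \<open>z (1 + z)\<^sup>3 / (1 - z)\<^sup>3\<close> at the point \<open>-R\<close>.
\<close>
lemma starlike_radius_class_G1:
  fixes \<alpha> :: real
  assumes \<alpha>: "\<alpha> < 1"
  shows "has_class_radius (starlike_ord \<alpha>) class_G1 ((1 - \<alpha>) / (3 + sqrt (10 - 2 * \<alpha> + \<alpha>\<^sup>2)))"
proof -
  define R where "R = (1 - \<alpha>) / (3 + sqrt (3\<^sup>2 + (1 - \<alpha>)\<^sup>2))"
  note root = quadratic_root_pos_leading[of "1 - \<alpha>" 3, folded R_def]
  have R: "0 < R" "R < 1" using root(1,2) \<alpha> by auto
  let ?q = "\<lambda>z. cayley_map z * cayley_map z * cayley_map z"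
  have "has_class_radius (starlike_ord \<alpha>) class_G1 R"
  proof (rule has_class_radius_starlikeI[OF R])
    show "class_G1 \<subseteq> class_A" by (auto simp: class_G1_iff)
  next
    fix f assume "f \<in> class_G1"
    then obtain p1 p2 p3 where p: "p1 \<in> class_P" "p2 \<in> class_P" "p3 \<in> class_P"
      and f: "\<And>z. z \<in> ball 0 1 \<Longrightarrow> f z = z * (p1 z * p2 z * p3 z)"
      unfolding class_G1_iff by blast
    show "\<exists>q. zero_free_factor f q \<and> (\<forall>w. norm w < R \<longrightarrow> \<alpha> < 1 + Re (euler_log_deriv q w))"
    proof (intro exI conjI allI impI)
      show "zero_free_factor f (\<lambda>z. p1 z * p2 z * p3 z)"
        using p f by (rule zero_free_factor_class_P_mult3)
      fix w :: complex assume w: "norm w < R"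
      have w1: "norm w < 1" using w R by simp
      have "2 * 3 * norm w / (1 - (norm w)\<^sup>2) < 1 - \<alpha>" using root(4)[of "norm w"] \<alpha> w by simp
      thus "\<alpha> < 1 + Re (euler_log_deriv (\<lambda>z. p1 z * p2 z * p3 z) w)"
        using class_P_euler_log_deriv_ge[OF p(1) w1] class_P_euler_log_deriv_ge[OF p(2) w1]
          class_P_euler_log_deriv_ge[OF p(3) w1]
        by (simp add: euler_log_deriv_class_P_mult3[OF p w1])
    qed
  next
    show "(\<lambda>z. z * ?q z) \<in> class_G1"
      unfolding class_G1_iff
      by (intro conjI class_A_id_mult bexI[OF _ cayley_map_class_P] holomorphic_intros
            class_PD(1)[OF cayley_map_class_P]) auto
    show "zero_free_factor (\<lambda>z. z * ?q z) ?q"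
      using cayley_map_class_P cayley_map_class_P cayley_map_class_P refl
      by (rule zero_free_factor_class_P_mult3)
    show "norm (- of_real R :: complex) = R" using R by simp
    have "norm (- of_real R :: complex) < 1" using R by simp
    hence "euler_log_deriv ?q (- of_real R) = of_real (- (2 * 3 * R / (1 - R\<^sup>2)))"
      using euler_log_deriv_class_P_mult3[OF cayley_map_class_P cayley_map_class_P cayley_map_class_P]
        euler_log_deriv_cayley_map[of R] R by simp
    also have "2 * 3 * R / (1 - R\<^sup>2) = 1 - \<alpha>" using root(3) \<alpha> by simp
    finally show "1 + Re (euler_log_deriv ?q (- of_real R)) \<le> \<alpha>" by simp
  qed
  moreover have "3\<^sup>2 + (1 - \<alpha>)\<^sup>2 = 10 - 2 * \<alpha> + \<alpha>\<^sup>2" by (simp add: power2_eq_square algebra_simps)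
  ultimately show ?thesis by (simp only: R_def)
qed

text \<open>
  The bound is attained by \<open>z (1 + z)\<^sup>2 / (1 - z)\<^sup>3\<close> at the point \<open>-R\<close>. The middle factor
  \<open>1 / (1 - z)\<close> and the Cayley maps reach their minima at the same point, so no contribution
  is lost in the sum.
\<close>
lemma starlike_radius_class_G2:
  fixes \<alpha> :: real
  assumes \<alpha>: "0 \<le> \<alpha>" "\<alpha> < 1"
  shows "has_class_radius (starlike_ord \<alpha>) class_G2
           (2 * (1 - \<alpha>) / (5 + sqrt (25 - 4 * \<alpha> + 4 * \<alpha>\<^sup>2)))"
proof -
  define R where "R = 2 * (1 - \<alpha>) / (5 + sqrt (25 - 4 * \<alpha> + 4 * \<alpha>\<^sup>2))"
  note root = quadratic_root_class_G2[OF \<alpha>, folded R_def]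
  have R: "0 < R" "R < 1" using root(1,2) by auto
  note h = half_plane_map_class_P_ord_half
  let ?q = "\<lambda>z. cayley_map z * half_plane_map z * cayley_map z"
  have "has_class_radius (starlike_ord \<alpha>) class_G2 R"
  proof (rule has_class_radius_starlikeI[OF R])
    show "class_G2 \<subseteq> class_A" by (auto simp: class_G2_iff)
  next
    fix f assume "f \<in> class_G2"
    then obtain p1 p2 p3 where p: "p1 \<in> class_P" "p2 \<in> class_P_ord (1/2)" "p3 \<in> class_P"
      and f: "\<And>z. z \<in> ball 0 1 \<Longrightarrow> f z = z * (p1 z * p2 z * p3 z)"
      unfolding class_G2_iff by blast
    note p2 = class_P_ord_imp_class_P[OF p(2)]
    show "\<exists>q. zero_free_factor f q \<and> (\<forall>w. norm w < R \<longrightarrow> \<alpha> < 1 + Re (euler_log_deriv q w))"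
    proof (intro exI conjI allI impI)
      show "zero_free_factor f (\<lambda>z. p1 z * p2 z * p3 z)"
        using p(1) p2 p(3) f by (rule zero_free_factor_class_P_mult3)
      fix w :: complex assume w: "norm w < R"
      have w1: "norm w < 1" "norm w \<le> 1/3" using w R root(2) by auto
      have "4 * norm w / (1 - (norm w)\<^sup>2) + norm w / (1 + norm w) < 1 - \<alpha>"
        using root(4)[of "norm w"] w by simp
      thus "\<alpha> < 1 + Re (euler_log_deriv (\<lambda>z. p1 z * p2 z * p3 z) w)"
        using class_P_euler_log_deriv_ge[OF p(1) w1(1)] class_P_half_euler_log_deriv_ge[OF p(2) w1(2)]
          class_P_euler_log_deriv_ge[OF p(3) w1(1)]
        by (simp add: euler_log_deriv_class_P_mult3[OF p(1) p2 p(3) w1(1)])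
    qed
  next
    show "(\<lambda>z. z * ?q z) \<in> class_G2"
      unfolding class_G2_iff
      by (intro conjI class_A_id_mult bexI[OF _ cayley_map_class_P] bexI[OF _ h] holomorphic_intros
            class_PD(1)[OF cayley_map_class_P]) auto
    show "zero_free_factor (\<lambda>z. z * ?q z) ?q"
      using cayley_map_class_P class_P_ord_imp_class_P[OF h] cayley_map_class_P refl
      by (rule zero_free_factor_class_P_mult3)
    show "norm (- of_real R :: complex) = R" using R by simp
    have "norm (- of_real R :: complex) < 1" using R by simp
    hence "euler_log_deriv ?q (- of_real R) = of_real (- (4 * R / (1 - R\<^sup>2) + R / (1 + R)))"
      using euler_log_deriv_class_P_mult3[OF cayley_map_class_P class_P_ord_imp_class_P[OF h]
          cayley_map_class_P]
        euler_log_deriv_cayley_map[of R] euler_log_deriv_half_plane_map[of R] R by simp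
    also have "4 * R / (1 - R\<^sup>2) + R / (1 + R) = 1 - \<alpha>" by (rule root(3))
    finally show "1 + Re (euler_log_deriv ?q (- of_real R)) \<le> \<alpha>" by simp
  qed
  thus ?thesis by (simp only: R_def)
qed

text \<open>
  The bound is attained by \<open>z (1 + z)\<^sup>2 / (1 - z)\<^sup>2\<close> at the point \<open>-R\<close>.
\<close>
lemma starlike_radius_class_G3:
  fixes \<alpha> :: real
  assumes \<alpha>: "\<alpha> < 1"
  shows "has_class_radius (starlike_ord \<alpha>) class_G3 ((1 - \<alpha>) / (2 + sqrt (5 - 2 * \<alpha> + \<alpha>\<^sup>2)))"
proof -
  define R where "R = (1 - \<alpha>) / (2 + sqrt (2\<^sup>2 + (1 - \<alpha>)\<^sup>2))"
  note root = quadratic_root_pos_leading[of "1 - \<alpha>" 2, folded R_def]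
  have R: "0 < R" "R < 1" using root(1,2) \<alpha> by auto
  let ?q = "\<lambda>z. cayley_map z * cayley_map z"
  have "has_class_radius (starlike_ord \<alpha>) class_G3 R"
  proof (rule has_class_radius_starlikeI[OF R])
    show "class_G3 \<subseteq> class_A" by (auto simp: class_G3_iff)
  next
    fix f assume "f \<in> class_G3"
    then obtain p1 p2 where p: "p1 \<in> class_P" "p2 \<in> class_P"
      and f: "\<And>z. z \<in> ball 0 1 \<Longrightarrow> f z = z * (p1 z * p2 z)"
      unfolding class_G3_iff by blast
    show "\<exists>q. zero_free_factor f q \<and> (\<forall>w. norm w < R \<longrightarrow> \<alpha> < 1 + Re (euler_log_deriv q w))"
    proof (intro exI conjI allI impI)
      show "zero_free_factor f (\<lambda>z. p1 z * p2 z)"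
        using p f by (rule zero_free_factor_class_P_mult)
      fix w :: complex assume w: "norm w < R"
      have w1: "norm w < 1" using w R by simp
      have "2 * 2 * norm w / (1 - (norm w)\<^sup>2) < 1 - \<alpha>" using root(4)[of "norm w"] \<alpha> w by simp
      thus "\<alpha> < 1 + Re (euler_log_deriv (\<lambda>z. p1 z * p2 z) w)"
        using class_P_euler_log_deriv_ge[OF p(1) w1] class_P_euler_log_deriv_ge[OF p(2) w1]
        by (simp add: euler_log_deriv_class_P_mult[OF p w1])
    qed
  next
    show "(\<lambda>z. z * ?q z) \<in> class_G3"
      unfolding class_G3_iff
      by (intro conjI class_A_id_mult bexI[OF _ cayley_map_class_P] holomorphic_intros
            class_PD(1)[OF cayley_map_class_P]) auto
    show "zero_free_factor (\<lambda>z. z * ?q z) ?q"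
      using cayley_map_class_P cayley_map_class_P refl by (rule zero_free_factor_class_P_mult)
    show "norm (- of_real R :: complex) = R" using R by simp
    have "norm (- of_real R :: complex) < 1" using R by simp
    hence "euler_log_deriv ?q (- of_real R) = of_real (- (2 * 2 * R / (1 - R\<^sup>2)))"
      using euler_log_deriv_class_P_mult[OF cayley_map_class_P cayley_map_class_P]
        euler_log_deriv_cayley_map[of R] R by simp
    also have "2 * 2 * R / (1 - R\<^sup>2) = 1 - \<alpha>" using root(3) \<alpha> by simp
    finally show "1 + Re (euler_log_deriv ?q (- of_real R)) \<le> \<alpha>" by simp
  qed
  moreover have "2\<^sup>2 + (1 - \<alpha>)\<^sup>2 = 5 - 2 * \<alpha> + \<alpha>\<^sup>2" by (simp add: power2_eq_square algebra_simps)
  ultimately show ?thesis by (simp only: R_def)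
qed

theorem theorem3p1:
  fixes \<alpha> :: real
  assumes "0 \<le> \<alpha>" and "\<alpha> < 1"
  shows "has_class_radius (starlike_ord \<alpha>) class_G1
           ((1 - \<alpha>) / (3 + sqrt (10 - 2 * \<alpha> + \<alpha>\<^sup>2)))
       \<and> has_class_radius (starlike_ord \<alpha>) class_G2
           (2 * (1 - \<alpha>) / (5 + sqrt (25 - 4 * \<alpha> + 4 * \<alpha>\<^sup>2)))
       \<and> has_class_radius (starlike_ord \<alpha>) class_G3
           ((1 - \<alpha>) / (2 + sqrt (5 - 2 * \<alpha> + \<alpha>\<^sup>2)))"
  using assms by (intro conjI starlike_radius_class_G1 starlike_radius_class_G2 starlike_radius_class_G3)

end
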